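(* Let $T=(T_{ab})_{a,b=1}^{\ell}$ be a square complex block matrix that is block tridiagonal with respect to $\ell$ principal layers labeled $a=1,2,\dots,\ell$. Let the ordered set of layers $\{1,\dots,\ell\}$ be partitioned into nonempty contiguous sub-domains which, from left to right, alternate as $$\mathcal{D}_2^{1},\ \mathcal{D}_1^{1},\ \mathcal{D}_2^{2},\ \mathcal{D}_1^{2},\ \dots,\ \mathcal{D}_2^{\ell_2},\ \mathcal{D}_1^{\ell_1},\qquad \ell_1=\ell_2\ge 1,$$ and set $\mathcal{D}_1=\bigcup_{i}\mathcal{D}_1^{i}$ and $\mathcal{D}_2=\bigcup_{i}\mathcal{D}_2^{i}$. Let $$\widehat{T}=R_3TR_3^{T}=\begin{pmatrix}\widehat{T}_{11}&\widehat{T}_{12}\\ \widehat{T}_{21}&\widehat{T}_{22}\end{pmatrix}$$ be the matrix obtained by the block permutation $R_3$ which lists first the layers of $\mathcal{D}_1$ and then the layers of $\mathcal{D}_2$ (each in increasing order), and assume that $T$ and $\widehat{T}_{22}$ are invertible. Then the Schur complement $$\widehat{T}_S=\widehat{T}_{11}-\widehat{T}_{12}\,\widehat{T}_{22}^{-1}\,\widehat{T}_{21}$$ is also block tridiagonal (with respect to the layers of $\mathcal{D}_1$ listed in increasing order).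
   Context: A system with $\ell$ principal layers is modeled by a square complex block matrix $T=(T_{ab})_{a,b=1}^{\ell}$, where the block $T_{ab}$ has size $n_a\times n_b$ for given positive integers $n_1,\dots,n_\ell$ (so diagonal blocks are square). A block matrix whose block rows and block columns are indexed by the same ordered finite list of layers is block tridiagonal if its block in position $(p,q)$ of the list is zero whenever $|p-q|>1$. In $\widehat{T}$, the part $\widehat{T}_{ij}$ consists of the blocks $T_{ab}$ with $a\in\mathcal{D}_i$ and $b\in\mathcal{D}_j$, for $i,j\in\{1,2\}$; in particular $\widehat{T}_{11}$ and $\widehat{T}_S$ are block matrices indexed by the layers of $\mathcal{D}_1$ listed in increasing order, so that position $p$ in that list is the $p$-th smallest element of $\mathcal{D}_1$. *)

theory Defs
  imports
    "Jordan_Normal_Form.Matrix"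
    "Jordan_Normal_Form.Gauss_Jordan_Elimination"
    "HOL-Library.Disjoint_Sets"
begin

text \<open>
  A block matrix is a \<^typ>\<open>'a mat\<close> together with the list of layers that indexes its
  block rows and block columns; layer \<open>a\<close> has size \<open>n a\<close>. Layers carry the labels
  \<open>1, \<dots>, l\<close>, whereas positions in a list of layers and matrix indices start at 0.
\<close>

definition total_size :: "(nat \<Rightarrow> nat) \<Rightarrow> nat list \<Rightarrow> nat" where
  "total_size n L = sum_list (map n L)"

definition block_at :: "(nat \<Rightarrow> nat) \<Rightarrow> nat list \<Rightarrow> 'a mat \<Rightarrow> nat \<Rightarrow> nat \<Rightarrow> 'a mat" where
  "block_at n L A p q =
     mat (n (L ! p)) (n (L ! q))
       (\<lambda>(i, j). A $$ (total_size n (take p L) + i, total_size n (take q L) + j))"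

definition block_tridiagonal :: "(nat \<Rightarrow> nat) \<Rightarrow> nat list \<Rightarrow> 'a::zero mat \<Rightarrow> bool" where
  "block_tridiagonal n L A \<longleftrightarrow>
     A \<in> carrier_mat (total_size n L) (total_size n L) \<and>
     (\<forall>p < length L. \<forall>q < length L. \<bar>int p - int q\<bar> > 1 \<longrightarrow>
        block_at n L A p q = 0\<^sub>m (n (L ! p)) (n (L ! q)))"

text \<open>
  Entry \<open>k\<close> of \<open>slots n L\<close> is the pair (layer, index inside that layer) to which the scalar
  row or column \<open>k\<close> belongs when the layers are listed as in \<open>L\<close>.
\<close>

definition slots :: "(nat \<Rightarrow> nat) \<Rightarrow> nat list \<Rightarrow> (nat \<times> nat) list" where
  "slots n L = concat (map (\<lambda>a. map (Pair a) [0..<n a]) L)"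

text \<open>
  The block permutation matrix from the listing \<open>L\<close> to the listing \<open>K\<close> of the same layers:
  its block in position \<open>(p, q)\<close> is the identity if \<open>K ! p = L ! q\<close>, and zero otherwise.
\<close>

definition block_perm_mat :: "(nat \<Rightarrow> nat) \<Rightarrow> nat list \<Rightarrow> nat list \<Rightarrow> 'a::{zero,one} mat" where
  "block_perm_mat n K L =
     mat (total_size n K) (total_size n L)
       (\<lambda>(i, j). if slots n K ! i = slots n L ! j then 1 else 0)"

definition contiguous :: "nat set \<Rightarrow> bool" where
  "contiguous D \<longleftrightarrow> (\<exists>a b. D = {a..b})"

text \<open>
  The sub-domains, from left to right, are
  \<open>D2 1, D1 1, D2 2, D1 2, \<dots>, D2 m, D1 m\<close>. Nonemptiness of each of them is part of
  \<^const>\<open>partition_on\<close>; the ordering conditions make sub-domains with different indices distinct.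
\<close>

definition alternating_partition ::
    "nat \<Rightarrow> nat \<Rightarrow> (nat \<Rightarrow> nat set) \<Rightarrow> (nat \<Rightarrow> nat set) \<Rightarrow> bool" where
  "alternating_partition l m D1 D2 \<longleftrightarrow>
     partition_on {1..l} (D1 ` {1..m} \<union> D2 ` {1..m}) \<and>
     (\<forall>i\<in>{1..m}. contiguous (D1 i) \<and> contiguous (D2 i)) \<and>
     (\<forall>i\<in>{1..m}. \<forall>a\<in>D2 i. \<forall>b\<in>D1 i. a < b) \<and>
     (\<forall>i\<in>{1..<m}. \<forall>a\<in>D1 i. \<forall>b\<in>D2 (Suc i). a < b)"

end

theory Submission
  imports Defs
begin

text \<open>
  Take layers \<open>a < c < b\<close> in \<open>dom1\<close>. Deleting \<open>c\<close> disconnects the path of layers, so the layers of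
  \<open>dom2\<close> split into those below and those above \<open>c\<close>, and the (2,2) part of the permuted matrix is
  block diagonal for this splitting; hence so is its inverse. The layer \<open>a\<close> is coupled only to
  layers of \<open>dom2\<close> below \<open>c\<close> and \<open>b\<close> only to layers above \<open>c\<close>, so the correction term of the Schur
  complement vanishes between \<open>a\<close> and \<open>b\<close>.
\<close>

section \<open>Scalar indices, their layers, and block tridiagonality\<close>

lemma length_slots [simp]: "length (slots n L) = total_size n L"
  by (simp add: slots_def total_size_def length_concat comp_def)

lemma slots_append: "slots n (K @ L) = slots n K @ slots n L"
  by (simp add: slots_def)

lemma total_size_append: "total_size n (K @ L) = total_size n K + total_size n L"
  by (simp add: total_size_def)

lemma slots_decomp:
  assumes "p < length L"
  shows "slots n L =
    slots n (take p L) @ map (Pair (L ! p)) [0..<n (L ! p)] @ slots n (drop (Suc p) L)"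
proof -
  have "slots n L = slots n (take p L @ L ! p # drop (Suc p) L)"
    using assms by (simp add: id_take_nth_drop[symmetric])
  then show ?thesis
    by (simp add: slots_def)
qed

lemma slots_nth_block:
  assumes "p < length L" and "i < n (L ! p)"
  shows "slots n L ! (total_size n (take p L) + i) = (L ! p, i)"
  using assms by (subst slots_decomp[OF assms(1)]) (simp add: nth_append)

lemma block_index_less:
  assumes "p < length L" and "i < n (L ! p)"
  shows "total_size n (take p L) + i < total_size n L"
proof -
  have "total_size n L =
      total_size n (take p L) + n (L ! p) + total_size n (drop (Suc p) L)"
    using arg_cong[OF slots_decomp[OF assms(1), of n], of length] by simp
  then show ?thesis
    using assms(2) by simp
qed

lemma block_index_cases:
  assumes "r < total_size n L"
  obtains p i where "p < length L" "i < n (L ! p)" "r = total_size n (take p L) + i"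
  using assms
proof (induction L arbitrary: r thesis)
  case Nil
  then show ?case by (simp add: total_size_def)
next
  case (Cons a L)
  show ?case
  proof (cases "r < n a")
    case True
    then show ?thesis
      using Cons.prems(1)[of 0 r] by (simp add: total_size_def)
  next
    case False
    then have "r - n a < total_size n L"
      using Cons.prems(2) by (simp add: total_size_def)
    then obtain p i where "p < length L" "i < n (L ! p)"
        "r - n a = total_size n (take p L) + i"
      using Cons.IH by blast
    then show ?thesis
      using False Cons.prems(1)[of "Suc p" i] by (simp add: total_size_def)
  qed
qed

text \<open>Labels, unlike block positions, survive a change of listing, so they are the common
  language for the entries of \<open>T\<close> and of the permuted matrix.\<close>

definition layer_of :: "(nat \<Rightarrow> nat) \<Rightarrow> nat list \<Rightarrow> nat \<Rightarrow> nat" where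
  "layer_of n L r = fst (slots n L ! r)"

lemma layer_of_block:
  "\<lbrakk>p < length L; i < n (L ! p)\<rbrakk> \<Longrightarrow> layer_of n L (total_size n (take p L) + i) = L ! p"
  by (simp add: layer_of_def slots_nth_block)

lemma layer_of_in_set: "r < total_size n L \<Longrightarrow> layer_of n L r \<in> set L"
  by (erule block_index_cases) (simp add: layer_of_block)

lemma layer_of_append:
  "layer_of n (K @ L) r =
    (if r < total_size n K then layer_of n K r else layer_of n L (r - total_size n K))"
  by (simp add: layer_of_def slots_append nth_append)

text \<open>In this listing position \<open>p\<close> carries the label \<open>Suc p\<close>, so
  distances between labels are distances between positions.\<close>

lemma block_tridiagonal_interval_entry:
  assumes tri: "block_tridiagonal n [1..<Suc l] A"
    and r: "r < total_size n [1..<Suc l]" and s: "s < total_size n [1..<Suc l]"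
    and far: "\<bar>int (layer_of n [1..<Suc l] r) - int (layer_of n [1..<Suc l] s)\<bar> > 1"
  shows "A $$ (r, s) = 0"
proof -
  let ?L = "[1..<Suc l]"
  obtain p i where p: "p < length ?L" "i < n (?L ! p)" "r = total_size n (take p ?L) + i"
    using r by (rule block_index_cases)
  obtain q j where q: "q < length ?L" "j < n (?L ! q)" "s = total_size n (take q ?L) + j"
    using s by (rule block_index_cases)
  have "layer_of n ?L r = ?L ! p" "layer_of n ?L s = ?L ! q"
    by (simp_all only: p q layer_of_block)
  then have "layer_of n ?L r = Suc p" "layer_of n ?L s = Suc q"
    using p(1) q(1) by (simp_all del: upt_Suc)
  then have "block_at n ?L A p q = 0\<^sub>m (n (?L ! p)) (n (?L ! q))"
    using tri p(1) q(1) far unfolding block_tridiagonal_def by auto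
  from arg_cong[OF this, of "\<lambda>M. M $$ (i, j)"] show ?thesis
    using p q by (simp add: block_at_def del: upt_Suc)
qed

text \<open>Neighbours in \<open>L\<close> may have labels far apart, so a numerical distance would
  be the wrong test. Two positions more than 1 apart have a layer of \<open>L\<close> strictly
  between them, namely the successor of the smaller position.\<close>

lemma block_tridiagonalI:
  assumes "A \<in> carrier_mat (total_size n L) (total_size n L)"
    and "sorted_wrt (<) L"
    and zero: "\<And>r s c. \<lbrakk>r < total_size n L; s < total_size n L; c \<in> set L;
        layer_of n L r < c \<and> c < layer_of n L s \<or> layer_of n L s < c \<and> c < layer_of n L r\<rbrakk>
        \<Longrightarrow> A $$ (r, s) = 0"
  shows "block_tridiagonal n L A"
  unfolding block_tridiagonal_def
proof (intro conjI allI impI eq_matI)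
  fix p q i j
  assume pq: "p < length L" "q < length L" "\<bar>int p - int q\<bar> > 1"
    and ij: "i < dim_row (0\<^sub>m (n (L ! p)) (n (L ! q)) :: 'a mat)"
            "j < dim_col (0\<^sub>m (n (L ! p)) (n (L ! q)) :: 'a mat)"
  let ?r = "total_size n (take p L) + i" and ?s = "total_size n (take q L) + j"
  have less: "x < y \<Longrightarrow> y < length L \<Longrightarrow> L ! x < L ! y" for x y
    using assms(2) by (simp add: sorted_wrt_iff_nth_less)
  obtain c where "c \<in> set L" "L ! p < c \<and> c < L ! q \<or> L ! q < c \<and> c < L ! p"
  proof (cases "p < q")
    case True
    then show ?thesis
      using pq that[of "L ! Suc p"] less[of p "Suc p"] less[of "Suc p" q] by auto
  next
    case False
    then show ?thesis
      using pq that[of "L ! Suc q"] less[of q "Suc q"] less[of "Suc q" p] by auto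
  qed
  moreover have "layer_of n L ?r = L ! p" "layer_of n L ?s = L ! q"
    using pq ij by (simp_all add: layer_of_block)
  ultimately have "A $$ (?r, ?s) = 0"
    using pq ij by (intro zero[of _ _ c]) (auto intro: block_index_less)
  then show "block_at n L A p q $$ (i, j) = 0\<^sub>m (n (L ! p)) (n (L ! q)) $$ (i, j)"
    using ij by (simp add: block_at_def)
qed (use assms(1) in \<open>simp_all add: block_at_def\<close>)

section \<open>Zero patterns of triple products and of inverses\<close>

lemma index_mult3_eq_0:
  fixes A B C :: "'a::semiring_0 mat"
  assumes "A \<in> carrier_mat a b" "B \<in> carrier_mat b c" "C \<in> carrier_mat c d"
    and "i < a" "j < d"
    and zero: "\<And>r s. \<lbrakk>r < b; s < c; A $$ (i, r) \<noteq> 0; C $$ (s, j) \<noteq> 0\<rbrakk> \<Longrightarrow> B $$ (r, s) = 0"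
  shows "(A * B * C) $$ (i, j) = 0"
proof -
  have "(A * B * C) $$ (i, j) = (\<Sum>s<c. (\<Sum>r<b. A $$ (i, r) * B $$ (r, s)) * C $$ (s, j))"
    using assms(1-5) by (simp add: scalar_prod_def lessThan_atLeast0 del: assoc_mult_mat)
  also have "\<dots> = (\<Sum>s<c. \<Sum>r<b. A $$ (i, r) * B $$ (r, s) * C $$ (s, j))"
    by (simp add: sum_distrib_right)
  also have "\<dots> = 0"
  proof (intro sum.neutral ballI)
    fix r s
    assume "s \<in> {..<c}" "r \<in> {..<b}"
    then show "A $$ (i, r) * B $$ (r, s) * C $$ (s, j) = 0"
      using zero[of r s] by (cases "A $$ (i, r) = 0"; cases "C $$ (s, j) = 0") auto
  qed
  finally show ?thesis .
qed

lemma inverse_mat_block_diagonal: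
  fixes A B :: "'a::semiring_1 mat"
  assumes A: "A \<in> carrier_mat k k" and B: "B \<in> carrier_mat k k"
    and AB: "A * B = 1\<^sub>m k" and BA: "B * A = 1\<^sub>m k"
    and diag: "\<And>i j. \<lbrakk>i < k; j < k; P i \<noteq> P j\<rbrakk> \<Longrightarrow> A $$ (i, j) = 0"
    and ij: "i < k" "j < k" "P i \<noteq> P j"
  shows "B $$ (i, j) = 0"
proof -
  \<comment> \<open>The diagonal part of \<open>B\<close> is again a right inverse of \<open>A\<close>.\<close>
  define C where "C = mat k k (\<lambda>(i, j). if P i = P j then B $$ (i, j) else 0)"
  have C: "C \<in> carrier_mat k k"
    by (simp add: C_def)
  have "A * C = 1\<^sub>m k"
  proof (rule eq_matI)
    fix i j
    assume "i < dim_row (1\<^sub>m k :: 'a mat)" "j < dim_col (1\<^sub>m k :: 'a mat)"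
    then have ij: "i < k" "j < k"
      by simp_all
    have "(A * C) $$ (i, j) = (\<Sum>r<k. A $$ (i, r) * C $$ (r, j))"
      using A C ij by (simp add: scalar_prod_def lessThan_atLeast0)
    \<comment> \<open>If \<open>P i = P j\<close>, an index \<open>r\<close> outside this class
      contributes 0 on both sides, since \<open>A $$ (i, r) = 0\<close>. If \<open>P i\<close> and
      \<open>P j\<close> differ, \<open>r\<close> misses one of the two classes, so one factor on
      the left vanishes.\<close>
    also have "\<dots> = (\<Sum>r<k. if P i = P j then A $$ (i, r) * B $$ (r, j) else 0)"
      using ij diag[of i] by (intro sum.cong) (auto simp: C_def)
    also have "\<dots> = (if P i = P j then (A * B) $$ (i, j) else 0)"
      using A B ij by (simp add: scalar_prod_def lessThan_atLeast0)
    also have "\<dots> = 1\<^sub>m k $$ (i, j)"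
      using ij by (auto simp: AB)
    finally show "(A * C) $$ (i, j) = 1\<^sub>m k $$ (i, j)" .
  qed (use A C in simp_all)
  then have "B = B * (A * C)"
    using B by simp
  also have "\<dots> = C"
    using A B C BA by (simp flip: assoc_mult_mat)
  finally have "B $$ (i, j) = C $$ (i, j)"
    by (rule arg_cong)
  then show ?thesis
    using ij by (simp add: C_def)
qed

text \<open>An invertible matrix is a unit of the matrix ring, which excludes the value
  \<open>None\<close>; hence \<open>the\<close> yields the true inverse.\<close>

lemma mat_inverse_invertible:
  fixes A :: "'a::field mat"
  assumes "A \<in> carrier_mat k k" "invertible_mat A"
  shows "the (mat_inverse A) \<in> carrier_mat k k"
    and "A * the (mat_inverse A) = 1\<^sub>m k"
    and "the (mat_inverse A) * A = 1\<^sub>m k"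
proof -
  obtain B where B: "A * B = 1\<^sub>m (dim_row A)" "B * A = 1\<^sub>m (dim_row B)"
    using assms(2) unfolding invertible_mat_def inverts_mat_def by blast
  \<comment> \<open>Invertibility does not state the shape of \<open>B\<close>; it is read off from
    the column counts of the two products.\<close>
  have "dim_row B = k" "dim_col B = k"
    using arg_cong[OF B(2), of dim_col] arg_cong[OF B(1), of dim_col] assms(1) by simp_all
  then have "A \<in> Units (ring_mat TYPE('a) k ())"
    using assms(1) B unfolding Units_def ring_mat_simps by auto
  then obtain C where "mat_inverse A = Some C"
    using mat_inverse(1)[OF assms(1), of "()"] by (cases "mat_inverse A") auto
  then show "the (mat_inverse A) \<in> carrier_mat k k"
    and "A * the (mat_inverse A) = 1\<^sub>m k"
    and "the (mat_inverse A) * A = 1\<^sub>m k"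
    using mat_inverse(2)[OF assms(1)] by auto
qed

section \<open>Disjointness of the domains and entries of the permuted matrix\<close>

text \<open>\<open>partition_on\<close> sees only the set of sub-domains and by itself would allow
  \<open>D1 i = D2 j\<close>. The left-to-right order excludes a common element.\<close>

lemma alternating_partition_disjoint:
  assumes ap: "alternating_partition l m D1 D2"
    and ij: "i \<in> {1..m}" "j \<in> {1..m}"
  shows "D1 i \<inter> D2 j = {}"
proof -
  have on: "partition_on {1..l} (D1 ` {1..m} \<union> D2 ` {1..m})"
    and D21: "\<And>k a b. \<lbrakk>k \<in> {1..m}; a \<in> D2 k; b \<in> D1 k\<rbrakk> \<Longrightarrow> a < b"
    and D12: "\<And>k a b. \<lbrakk>k \<in> {1..<m}; a \<in> D1 k; b \<in> D2 (Suc k)\<rbrakk> \<Longrightarrow> a < b"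
    using ap by (auto simp: alternating_partition_def)
  have ne: "\<exists>x. x \<in> D1 k" "\<exists>x. x \<in> D2 k" if "k \<in> {1..m}" for k
    using partition_onD3[OF on] that by (metis UnI1 UnI2 ex_in_conv imageI)+
  \<comment> \<open>The order is given only between neighbouring sub-domains; transitivity runs
    through elements of those in between, which are nonempty.\<close>
  have before: "x < y" if "p \<ge> 1" "p < k" "k \<le> m" "x \<in> D1 p" "y \<in> D2 k" for p k x y
    using that(2,3,5)
  proof (induction k arbitrary: y)
    case (Suc k)
    show ?case
    proof (cases "p = k")
      case True
      then show ?thesis
        using Suc.prems that(1,4) D12[of k x y] by simp
    next
      case False
      obtain z w where "z \<in> D2 k" "w \<in> D1 k"
        using ne[of k] False Suc.prems that(1) by auto
      then have "x < z" "z < w" "w < y"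
        using False Suc that(1) D21[of k z w] D12[of k w y] by auto
      then show ?thesis by simp
    qed
  qed simp
  have False if x: "x \<in> D1 i" "x \<in> D2 j" for x
  proof (cases i j rule: linorder_cases)
    case less
    then show ?thesis
      using before[of i j x x] x ij by simp
  next
    case equal
    then show ?thesis
      using D21[of i x x] x ij by simp
  next
    case greater
    \<comment> \<open>Here \<open>x\<close> would lie left of \<open>D1 j\<close> and right of
      \<open>D2 i\<close>, although \<open>D1 j\<close> precedes \<open>D2 i\<close>; the witnesses
      give the cycle \<open>x < u < v < x\<close>.\<close>
    obtain u v where uv: "u \<in> D1 j" "v \<in> D2 i"
      using ne ij by blast
    then have "x < u" "u < v" "v < x"
      using D21[of j x u] D21[of i v x] before[of j i u v] x ij greater by auto
    then show ?thesis by simp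
  qed
  then show ?thesis by blast
qed

text \<open>Nonzero entries of \<open>R\<close> link equal slots, hence equal layers. So only
  entries of \<open>T\<close> between the layers of \<open>i\<close> and \<open>j\<close> can
  contribute, and these vanish for distant layers.\<close>

lemma block_perm_conj_entry:
  fixes T :: "'a::comm_ring_1 mat"
  assumes tri: "block_tridiagonal n [1..<Suc l] T"
    and R: "R = block_perm_mat n K [1..<Suc l]"
    and ij: "i < total_size n K" "j < total_size n K"
    and far: "\<bar>int (layer_of n K i) - int (layer_of n K j)\<bar> > 1"
  shows "(R * T * transpose_mat R) $$ (i, j) = 0"
proof (rule index_mult3_eq_0)
  let ?L = "[1..<Suc l]"
  show R_carrier: "R \<in> carrier_mat (total_size n K) (total_size n ?L)"
    unfolding R block_perm_mat_def by simp
  then show "transpose_mat R \<in> carrier_mat (total_size n ?L) (total_size n K)"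
    by simp
  show "T \<in> carrier_mat (total_size n ?L) (total_size n ?L)"
    using tri by (simp add: block_tridiagonal_def)
  fix r s
  assume rs: "r < total_size n ?L" "s < total_size n ?L"
    and nz: "R $$ (i, r) \<noteq> 0" "transpose_mat R $$ (s, j) \<noteq> 0"
  have eq: "slots n K ! x = slots n ?L ! y"
    if "R $$ (x, y) \<noteq> 0" "x < total_size n K" "y < total_size n ?L" for x y
    using that unfolding R block_perm_mat_def by (simp del: upt_Suc split: if_splits)
  have "R $$ (j, s) \<noteq> 0"
    using nz(2) rs ij R_carrier by (simp del: upt_Suc)
  then have "layer_of n K i = layer_of n ?L r" "layer_of n K j = layer_of n ?L s"
    using eq[OF nz(1)] eq[of j s] rs ij unfolding layer_of_def by simp_all
  then show "T $$ (r, s) = 0"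
    using block_tridiagonal_interval_entry[OF tri rs] far by simp
qed (use ij in simp_all)

section \<open>The Schur complement\<close>

theorem proposition4:
  fixes l l1 l2 :: nat
    and n :: "nat \<Rightarrow> nat"
    and D1 D2 :: "nat \<Rightarrow> nat set"
    and dom1 dom2 :: "nat set"
    and T R3 That T11 T12 T21 T22 :: "complex mat"
  assumes sizes_pos: "\<And>a. a \<in> {1..l} \<Longrightarrow> n a > 0"
    and T_tridiagonal: "block_tridiagonal n [1..<Suc l] T"
    and counts: "l1 = l2" "l2 \<ge> 1"
    and partition: "alternating_partition l l1 D1 D2"
    and dom1: "dom1 = (\<Union>i\<in>{1..l1}. D1 i)"
    and dom2: "dom2 = (\<Union>i\<in>{1..l2}. D2 i)"
    and R3: "R3 = block_perm_mat n
               (sorted_list_of_set dom1 @ sorted_list_of_set dom2) [1..<Suc l]"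
    and That: "That = R3 * T * transpose_mat R3"
    and parts: "(T11, T12, T21, T22) =
                  split_block That (total_size n (sorted_list_of_set dom1))
                                   (total_size n (sorted_list_of_set dom1))"
    and T_invertible: "invertible_mat T"
    and T22_invertible: "invertible_mat T22"
  shows "block_tridiagonal n (sorted_list_of_set dom1)
           (T11 - T12 * the (mat_inverse T22) * T21)"
proof -
  define S1 S2 where "S1 = sorted_list_of_set dom1" and "S2 = sorted_list_of_set dom2"
  define N1 N2 where "N1 = total_size n S1" and "N2 = total_size n S2"
  define X where "X = the (mat_inverse T22)"
  have on: "partition_on {1..l} (D1 ` {1..l1} \<union> D2 ` {1..l1})"
    using partition by (simp add: alternating_partition_def)
  have "dom1 \<union> dom2 = {1..l}"
    using partition_onD1[OF on] dom1 dom2 counts(1) by auto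
  \<comment> \<open>For an infinite set \<open>sorted_list_of_set\<close> would be the empty list;
    finiteness makes the elements of \<open>S1\<close> and \<open>S2\<close> those of
    \<open>dom1\<close> and \<open>dom2\<close>.\<close>
  then have fin: "finite dom1" "finite dom2"
    by (metis finite_Un finite_atLeastAtMost)+
  have disj: "dom1 \<inter> dom2 = {}"
    using alternating_partition_disjoint[OF partition] dom1 dom2 counts(1) by blast

  have That_carrier: "That \<in> carrier_mat (N1 + N2) (N1 + N2)"
    unfolding That R3 block_perm_mat_def N1_def N2_def S1_def S2_def
    by (intro carrier_matI) (simp_all add: total_size_append del: upt_Suc)
  have That_zero: "That $$ (i, j) = 0"
    if "i < N1 + N2" "j < N1 + N2"
      "\<bar>int (layer_of n (S1 @ S2) i) - int (layer_of n (S1 @ S2) j)\<bar> > 1" for i j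
    using that block_perm_conj_entry[OF T_tridiagonal R3]
    by (simp add: That S1_def S2_def N1_def N2_def total_size_append)
  have Ts: "T11 = mat N1 N1 (\<lambda>(i, j). That $$ (i, j))"
           "T12 = mat N1 N2 (\<lambda>(i, j). That $$ (i, j + N1))"
           "T21 = mat N2 N1 (\<lambda>(i, j). That $$ (i + N1, j))"
           "T22 = mat N2 N2 (\<lambda>(i, j). That $$ (i + N1, j + N1))"
    using parts That_carrier
    by (auto simp: split_block_def Let_def N1_def[symmetric] S1_def[symmetric])
  \<comment> \<open>Labels in \<open>S1 @ S2\<close> are those of \<open>S1\<close> below
    \<open>N1\<close> and those of \<open>S2\<close>, shifted by \<open>N1\<close>, from there on;
    so each part inherits the zero pattern of \<open>That\<close>.\<close>
  have T11_zero: "T11 $$ (i, j) = 0"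
    if "i < N1" "j < N1" "\<bar>int (layer_of n S1 i) - int (layer_of n S1 j)\<bar> > 1" for i j
    using that That_zero[of i j] by (simp add: Ts layer_of_append N1_def)
  have T12_zero: "T12 $$ (i, j) = 0"
    if "i < N1" "j < N2" "\<bar>int (layer_of n S1 i) - int (layer_of n S2 j)\<bar> > 1" for i j
    using that That_zero[of i "j + N1"] by (simp add: Ts layer_of_append N1_def)
  have T21_zero: "T21 $$ (i, j) = 0"
    if "i < N2" "j < N1" "\<bar>int (layer_of n S2 i) - int (layer_of n S1 j)\<bar> > 1" for i j
    using that That_zero[of "i + N1" j] by (simp add: Ts layer_of_append N1_def)
  have T22_zero: "T22 $$ (i, j) = 0"
    if "i < N2" "j < N2" "\<bar>int (layer_of n S2 i) - int (layer_of n S2 j)\<bar> > 1" for i j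
    using that That_zero[of "i + N1" "j + N1"] by (simp add: Ts layer_of_append N1_def)
  have carriers: "T11 \<in> carrier_mat N1 N1" "T12 \<in> carrier_mat N1 N2"
      "T21 \<in> carrier_mat N2 N1" "T22 \<in> carrier_mat N2 N2"
    by (simp_all add: Ts)
  note X = mat_inverse_invertible[OF carriers(4) T22_invertible, folded X_def]

  have "block_tridiagonal n S1 (T11 - T12 * X * T21)"
  proof (rule block_tridiagonalI)
    show "T11 - T12 * X * T21 \<in> carrier_mat (total_size n S1) (total_size n S1)"
      using carriers X(1) by (simp add: N1_def minus_carrier_mat)
    show "sorted_wrt (<) S1"
      by (simp add: S1_def)
    fix r s c
    assume r: "r < total_size n S1" and s: "s < total_size n S1" and c: "c \<in> set S1"
      and sep: "layer_of n S1 r < c \<and> c < layer_of n S1 s \<or>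
                layer_of n S1 s < c \<and> c < layer_of n S1 r"
    \<comment> \<open>Hence every layer of \<open>dom2\<close> is strictly on one side of
      \<open>c\<close>, and being below \<open>c\<close> splits the indices of \<open>T22\<close>
      into two classes.\<close>
    have c_notin: "layer_of n S2 i \<noteq> c" if "i < N2" for i
      using layer_of_in_set[of i n S2] that c disj fin by (auto simp: N2_def S1_def S2_def)
    have X_zero: "X $$ (i, j) = 0"
      if "i < N2" "j < N2" "(layer_of n S2 i < c) \<noteq> (layer_of n S2 j < c)" for i j
    proof (rule inverse_mat_block_diagonal[OF carriers(4) X(1-3) _ that])
      fix i j
      assume ij: "i < N2" "j < N2" "(layer_of n S2 i < c) \<noteq> (layer_of n S2 j < c)"
      then show "T22 $$ (i, j) = 0"
        \<comment> \<open>Integers strictly on opposite sides of \<open>c\<close> differ by at least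
          2.\<close>
        using c_notin[of i] c_notin[of j] by (intro T22_zero) auto
    qed
    have "(T12 * X * T21) $$ (r, s) = 0"
    proof (rule index_mult3_eq_0[OF carriers(2) X(1) carriers(3)])
      show "r < N1" "s < N1"
        using r s by (simp_all add: N1_def)
      fix i j
      assume ij: "i < N2" "j < N2" and nz: "T12 $$ (r, i) \<noteq> 0" "T21 $$ (j, s) \<noteq> 0"
      \<comment> \<open>A layer within distance 1 of that of \<open>r\<close> could reach
        \<open>c\<close> but not pass it, and it is not \<open>c\<close>. So \<open>i\<close> is on
        the side of \<open>r\<close>, likewise \<open>j\<close> on that of \<open>s\<close>, and
        these sides are opposite.\<close>
      have "\<bar>int (layer_of n S1 r) - int (layer_of n S2 i)\<bar> \<le> 1"
          "\<bar>int (layer_of n S2 j) - int (layer_of n S1 s)\<bar> \<le> 1"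
        using nz T12_zero[of r i] T21_zero[of j s] ij r s by (force simp: N1_def)+
      then show "X $$ (i, j) = 0"
        using ij sep c_notin[of i] c_notin[of j] by (intro X_zero) auto
    qed
    moreover have "T11 $$ (r, s) = 0"
      using r s sep by (intro T11_zero) (auto simp: N1_def)
    ultimately show "(T11 - T12 * X * T21) $$ (r, s) = 0"
      using r s carriers X(1) by (simp add: N1_def)
  qed
  then show ?thesis
    by (simp add: S1_def X_def)
qed

end
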